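(* Let $\kappa\le\lambda$ be cardinals with $\kappa$ regular and uncountable. Suppose $\operatorname{cf}\lambda\ge\kappa$ and $\square_{\operatorname{cof}(<\kappa)}(\kappa,\lambda)$ holds. Then $\mathsf{ITP}(\kappa,\lambda)$ fails.
   Context: $\mathrm{Lim}$ is the class of limit ordinals, $\operatorname{Lim}C$ the set of limit points of a set of ordinals $C$, and $\operatorname{cof}(<\kappa)$ the class of ordinals of cofinality $<\kappa$. For $E$ a class of ordinals, a $\square_E(\kappa,\lambda)$-sequence is $\langle\mathcal C_\alpha\mid\alpha\in\mathrm{Lim}\cap E\cap\lambda\rangle$ such that (i) $0<|\mathcal C_\alpha|<\kappa$; (ii) every $C\in\mathcal C_\alpha$ is club in $\alpha$; (iii) $C\cap\beta\in\mathcal C_\beta$ whenever $C\in\mathcal C_\alpha$ and $\beta\in\operatorname{Lim}C$; (iv) there is no club $D\subseteq\lambda$ with $D\cap\delta\in\mathcal C_\delta$ for all $\delta\in\operatorname{Lim}D\cap E\cap\lambda$. $\square_E(\kappa,\lambda)$ holds if such a sequence exists. A $P_\kappa\lambda$-list is $\langle d_a\mid a\in P_\kappa\lambda\rangle$ with $d_a\subseteq a$ ($P_\kappa\lambda$ = subsets of $\lambda$ of size $<\kappa$); it is thin if there is a club $C\subseteq P_\kappa\lambda$ with $|\{d_a\cap c\mid c\subseteq a\in P_\kappa\lambda\}|<\kappa$ for all $c\in C$. $\mathsf{ITP}(\kappa,\lambda)$ states that every thin $P_\kappa\lambda$-list has an ineffable branch, i.e. a $d\subseteq\lambda$ such that $\{a\in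 P_\kappa\lambda\mid d\cap a=d_a\}$ is stationary in $P_\kappa\lambda$. *)

theory Defs
  imports Main
begin

unbundle cardinal_syntax

text \<open>
  Cardinals are the library's cardinal well-orders (\<^const>\<open>Card_order\<close>). Throughout, \<open>r\<close> is a
  well-order that plays the role of an ordinal \<open>\<lambda>\<close>: the ordinals below \<open>\<lambda>\<close> are the elements
  of \<open>Field r\<close>, and, as with von Neumann ordinals, an ordinal is identified with the set of its
  predecessors. So \<open>\<alpha> \<in> Field r\<close> becomes the set \<open>underS r \<alpha>\<close>, and \<open>\<lambda>\<close> itself becomes
  \<open>Field r\<close>. A class of ordinals is represented by its intersection with \<open>\<lambda>\<close>.
\<close>

definition limit_ordinals :: "'a rel \<Rightarrow> 'a set" where
  "limit_ordinals r = {\<alpha> \<in> Field r. underS r \<alpha> \<noteq> {} \<and>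
     (\<forall>\<xi>\<in>underS r \<alpha>. \<exists>\<eta>\<in>underS r \<alpha>. \<xi> \<in> underS r \<eta>)}"

definition limit_points :: "'a rel \<Rightarrow> 'a set \<Rightarrow> 'a set" where
  "limit_points r C = {\<beta> \<in> Field r. underS r \<beta> \<noteq> {} \<and>
     (\<forall>\<xi>\<in>underS r \<beta>. \<exists>\<eta>\<in>C \<inter> underS r \<beta>. \<xi> \<in> underS r \<eta>)}"

text \<open>
  In the next three definitions \<open>A\<close> is an initial segment of \<open>Field r\<close>, that is, an ordinal
  \<open>\<le> \<lambda>\<close>.
\<close>

definition unbounded_in :: "'a rel \<Rightarrow> 'a set \<Rightarrow> 'a set \<Rightarrow> bool" where
  "unbounded_in r A C \<longleftrightarrow> C \<subseteq> A \<and> (\<forall>\<xi>\<in>A. \<exists>\<eta>\<in>C. (\<xi>, \<eta>) \<in> r)"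

definition club_in :: "'a rel \<Rightarrow> 'a set \<Rightarrow> 'a set \<Rightarrow> bool" where
  "club_in r A C \<longleftrightarrow> unbounded_in r A C \<and> limit_points r C \<inter> A \<subseteq> C"

text \<open>
  The least cardinality of an unbounded subset, see \<open>cofinality_least\<close> below. As usual for
  cardinal well-orders, it is only meaningful up to \<open>=o\<close>. The library's \<^const>\<open>cofinal\<close> is not
  used because it asks for strictly larger elements, so that an ordinal with a maximum would have
  no cofinal subset at all.
\<close>

definition cofinality :: "'a rel \<Rightarrow> 'a set \<Rightarrow> 'a rel" where
  "cofinality r A = |SOME B. unbounded_in r A B \<and> (\<forall>B'. unbounded_in r A B' \<longrightarrow> |B| \<le>o |B'| )|"

lemma cofinality_least:
  assumes "Well_order r" and "A \<subseteq> Field r"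
  obtains B where "unbounded_in r A B" and "cofinality r A = |B|"
    and "\<And>B'. unbounded_in r A B' \<Longrightarrow> |B| \<le>o |B'|"
proof -
  have "Refl r"
    using assms(1) by (simp add: order_on_defs)
  then have "unbounded_in r A A"
    using assms(2) unfolding unbounded_in_def refl_on_def by blast
  then have ne: "card_of ` {B. unbounded_in r A B} \<noteq> {}"
    by blast
  have "\<forall>q\<in>card_of ` {B. unbounded_in r A B}. Well_order q"
    by (auto simp: card_of_Well_order)
  from exists_minim_Well_order[OF ne this]
  have "\<exists>B. unbounded_in r A B \<and> (\<forall>B'. unbounded_in r A B' \<longrightarrow> |B| \<le>o |B'| )"
    by auto
  from someI_ex[OF this] show thesis
    using that unfolding cofinality_def by blast
qed

definition cof_less :: "'b rel \<Rightarrow> 'a rel \<Rightarrow> 'a set" where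
  "cof_less \<kappa> r = {\<alpha> \<in> Field r. cofinality r (underS r \<alpha>) <o \<kappa>}"

text \<open>
  A sequence indexed by \<open>Lim \<inter> E \<inter> \<lambda>\<close> is a total function whose values outside the index
  set are irrelevant. Coherence is required at those limit points of \<open>C\<close> that lie in the index
  set (a limit point of \<open>C\<close> is automatically a limit ordinal below \<open>\<lambda>\<close>).
\<close>

definition square_sequence ::
  "'a set \<Rightarrow> 'b rel \<Rightarrow> 'a rel \<Rightarrow> ('a \<Rightarrow> 'a set set) \<Rightarrow> bool" where
  "square_sequence E \<kappa> r \<C> \<longleftrightarrow>
     (\<forall>\<alpha>\<in>limit_ordinals r \<inter> E. \<C> \<alpha> \<noteq> {} \<and> |\<C> \<alpha>| <o \<kappa>) \<and>
     (\<forall>\<alpha>\<in>limit_ordinals r \<inter> E. \<forall>C\<in>\<C> \<alpha>. club_in r (underS r \<alpha>) C) \<and>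
     (\<forall>\<alpha>\<in>limit_ordinals r \<inter> E. \<forall>C\<in>\<C> \<alpha>. \<forall>\<beta>\<in>limit_points r C \<inter> E. C \<inter> underS r \<beta> \<in> \<C> \<beta>) \<and>
     \<not> (\<exists>D. club_in r (Field r) D \<and> (\<forall>\<delta>\<in>limit_points r D \<inter> E. D \<inter> underS r \<delta> \<in> \<C> \<delta>))"

definition square :: "'a set \<Rightarrow> 'b rel \<Rightarrow> 'a rel \<Rightarrow> bool" where
  "square E \<kappa> r \<longleftrightarrow> (\<exists>\<C>. square_sequence E \<kappa> r \<C>)"

definition Pk :: "'b rel \<Rightarrow> 'a rel \<Rightarrow> 'a set set" where
  "Pk \<kappa> r = {a. a \<subseteq> Field r \<and> |a| <o \<kappa>}"

text \<open>
  Club subsets of \<open>P\<^sub>\<kappa>\<lambda>\<close>: cofinal with respect to inclusion and closed under unions of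
  increasing sequences of length \<open>\<gamma>\<close> for all \<open>0 < \<gamma> < \<kappa>\<close>.
\<close>

definition Pk_club :: "'b rel \<Rightarrow> 'a rel \<Rightarrow> 'a set set \<Rightarrow> bool" where
  "Pk_club \<kappa> r C \<longleftrightarrow> C \<subseteq> Pk \<kappa> r \<and>
     (\<forall>a\<in>Pk \<kappa> r. \<exists>c\<in>C. a \<subseteq> c) \<and>
     (\<forall>\<gamma>\<in>Field \<kappa>. \<forall>f. underS \<kappa> \<gamma> \<noteq> {} \<and> f ` underS \<kappa> \<gamma> \<subseteq> C \<and>
        (\<forall>\<xi>\<in>underS \<kappa> \<gamma>. \<forall>\<eta>\<in>underS \<kappa> \<gamma>. (\<xi>, \<eta>) \<in> \<kappa> \<longrightarrow> f \<xi> \<subseteq> f \<eta>) \<longrightarrow>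
        \<Union> (f ` underS \<kappa> \<gamma>) \<in> C)"

definition Pk_stationary :: "'b rel \<Rightarrow> 'a rel \<Rightarrow> 'a set set \<Rightarrow> bool" where
  "Pk_stationary \<kappa> r S \<longleftrightarrow> S \<subseteq> Pk \<kappa> r \<and> (\<forall>C. Pk_club \<kappa> r C \<longrightarrow> S \<inter> C \<noteq> {})"

definition Pk_list :: "'b rel \<Rightarrow> 'a rel \<Rightarrow> ('a set \<Rightarrow> 'a set) \<Rightarrow> bool" where
  "Pk_list \<kappa> r d \<longleftrightarrow> (\<forall>a\<in>Pk \<kappa> r. d a \<subseteq> a)"

definition thin :: "'b rel \<Rightarrow> 'a rel \<Rightarrow> ('a set \<Rightarrow> 'a set) \<Rightarrow> bool" where
  "thin \<kappa> r d \<longleftrightarrow>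
     (\<exists>C. Pk_club \<kappa> r C \<and> (\<forall>c\<in>C. |{d a \<inter> c | a. a \<in> Pk \<kappa> r \<and> c \<subseteq> a}| <o \<kappa>))"

definition ineffable_branch ::
  "'b rel \<Rightarrow> 'a rel \<Rightarrow> ('a set \<Rightarrow> 'a set) \<Rightarrow> 'a set \<Rightarrow> bool" where
  "ineffable_branch \<kappa> r d D \<longleftrightarrow>
     D \<subseteq> Field r \<and> Pk_stationary \<kappa> r {a \<in> Pk \<kappa> r. D \<inter> a = d a}"

definition ITP :: "'b rel \<Rightarrow> 'a rel \<Rightarrow> bool" where
  "ITP \<kappa> r \<longleftrightarrow>
     (\<forall>d. Pk_list \<kappa> r d \<and> thin \<kappa> r d \<longrightarrow> (\<exists>D. ineffable_branch \<kappa> r d D))"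

end

theory Submission
  imports Defs
begin

text \<open>
  For \<open>a \<in> P\<^sub>\<kappa>\<lambda>\<close> without maximum choose \<open>C\<^sub>a \<in> \<C>\<^bsub>sup a\<^esub>\<close>. The list \<open>d\<^sub>a = C\<^sub>a \<inter> a\<close> would
  be thin, but its branch could be bounded, since \<open>C\<^sub>a\<close> may be disjoint from \<open>a\<close>. Instead, \<open>d\<^sub>a\<close>
  records for which codes \<open>z \<in> a\<close> of pairs \<open>(x, y)\<close> the club \<open>C\<^sub>a\<close> meets the interval \<open>[x, y)\<close>.

  Thinness: given fewer than \<open>\<kappa>\<close> endpoints, the answers of a club \<open>C\<close> are determined by the set of
  those endpoints \<open>y\<close> that are the next endpoint above some element of \<open>C\<close>. Above its largest
  limit point \<open>\<gamma>\<close> this set is finite, and below \<open>\<gamma>\<close> it is determined by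
  \<open>C \<inter> \<gamma> \<in> \<C>\<^sub>\<gamma>\<close>, where \<open>\<gamma>\<close> is one of the fewer than \<open>\<kappa>\<close> limit points of the set of endpoints.

  Given a branch, any fewer than \<open>\<kappa>\<close> of its answers are the answers of a single club of the square
  sequence. As \<open>\<C>\<^sub>\<delta>\<close> has fewer than \<open>\<kappa>\<close> elements, at suitable \<open>\<delta>\<close> of cofinality \<open>< \<kappa>\<close> all
  answers below \<open>\<delta>\<close> come from a single member of \<open>\<C>\<^sub>\<delta>\<close>, so that the set of those \<open>\<xi>\<close> with a
  positive answer at \<open>[\<xi>, \<xi> + 1)\<close> threads the square sequence.
\<close>

section \<open>The order of \<lambda>\<close>

locale regular_le_cofinality =
  fixes \<kappa> :: "'b rel" and r :: "'a rel"
  assumes Card_order: "Card_order \<kappa>"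
    and regular: "regularCard \<kappa>"
    and uncountable: "natLeq <o \<kappa>"
    and Well_order: "Well_order r"
    and le_cofinality: "\<kappa> \<le>o cofinality r (Field r)"
begin

abbreviation less (infix "\<prec>" 50) where
  "x \<prec> y \<equiv> x \<in> underS r y"

lemma less_iff: "x \<prec> y \<longleftrightarrow> (x, y) \<in> r \<and> x \<noteq> y"
  by (auto simp: underS_def)

lemma less_Field: "x \<prec> y \<Longrightarrow> x \<in> Field r \<and> y \<in> Field r"
  by (auto simp: underS_def Field_def)

lemma le_iff: "(x, y) \<in> r \<longleftrightarrow> x \<in> Field r \<and> (x = y \<or> x \<prec> y)"
  using Well_order by (auto simp: underS_def Field_def order_on_defs refl_on_def)

lemma irrefl: "\<not> x \<prec> x"
  by (simp add: underS_def)

lemma trans: "x \<prec> y \<Longrightarrow> y \<prec> z \<Longrightarrow> x \<prec> z"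
  using Well_order unfolding less_iff order_on_defs trans_def antisym_def by blast

lemma total: "x \<in> Field r \<Longrightarrow> y \<in> Field r \<Longrightarrow> x \<prec> y \<or> x = y \<or> y \<prec> x"
  using Well_order unfolding less_iff order_on_defs total_on_def by blast

lemma least:
  assumes "P x\<^sub>0" and "x\<^sub>0 \<in> Field r"
  obtains m where "m \<in> Field r" and "P m" and "\<And>x. x \<prec> m \<Longrightarrow> \<not> P x"
proof -
  have "wf (r - Id)"
    using Well_order by (simp add: order_on_defs)
  moreover have "x\<^sub>0 \<in> {x \<in> Field r. P x}"
    using assms by blast
  ultimately show thesis
    by (rule wfE_min) (use that less_Field less_iff in auto)
qed

lemma Cinfinite: "Cinfinite \<kappa>"
proof -
  have "natLeq \<le>o |Field \<kappa>|"
    using uncountable Card_order card_of_Field_ordIso ordIso_symmetric ordLess_imp_ordLeq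
      ordLeq_ordIso_trans by blast
  then show ?thesis
    using Card_order infinite_iff_natLeq_ordLeq unfolding cinfinite_def by blast
qed

section \<open>Closure properties of sets of size less than \<kappa>\<close>

lemma small_UN: "|I| <o \<kappa> \<Longrightarrow> (\<And>i. i \<in> I \<Longrightarrow> |A i| <o \<kappa>) \<Longrightarrow> |\<Union>i\<in>I. A i| <o \<kappa>"
  using regularCard_UNION_bound[OF Cinfinite regular] .

lemma small_countable: "|A :: nat set| <o \<kappa>"
  using ordLeq_ordLess_trans[OF ordLeq_ordIso_trans[OF card_of_mono1 card_of_nat] uncountable]
  by blast

lemma small_finite: "finite A \<Longrightarrow> |A| <o \<kappa>"
  using finite_iff_ordLess_natLeq ordLess_transitive uncountable by blast

lemma small_image: "|A| <o \<kappa> \<Longrightarrow> |f ` A| <o \<kappa>"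
  using card_of_image ordLeq_ordLess_trans by blast

lemma small_mono: "|A| <o \<kappa> \<Longrightarrow> B \<subseteq> A \<Longrightarrow> |B| <o \<kappa>"
  using card_of_mono1 ordLeq_ordLess_trans by blast

lemma small_Un:
  assumes "|A| <o \<kappa>" and "|B| <o \<kappa>"
  shows "|A \<union> B| <o \<kappa>"
proof -
  have "|\<Union>b\<in>UNIV. if b then A else B| <o \<kappa>"
    by (rule small_UN) (use assms in \<open>auto intro: small_finite\<close>)
  then show ?thesis
    by (auto simp: UNIV_bool Un_commute)
qed

lemma small_Times:
  assumes "|A| <o \<kappa>" and "|B| <o \<kappa>"
  shows "|A \<times> B| <o \<kappa>"
proof -
  have "|\<Union>x\<in>A. Pair x ` B| <o \<kappa>"
    using assms by (intro small_UN small_image)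
  then show ?thesis
    by (rule small_mono) auto
qed

text \<open>Finite subsets are sorted by size. Those of size n + 1 arise from those of size n by
  inserting one element, and the union over all n stays small because \<kappa> is regular and
  uncountable.\<close>

lemma small_Fpow:
  assumes "|A| <o \<kappa>"
  shows "|Fpow A| <o \<kappa>"
proof -
  have *: "|{F. F \<subseteq> A \<and> finite F \<and> card F = n}| <o \<kappa>" for n
  proof (induction n)
    case 0
    have "{F. F \<subseteq> A \<and> finite F \<and> card F = 0} = {{}}"
      by auto
    then show ?case
      by (simp add: small_finite)
  next
    case (Suc n)
    have "{F. F \<subseteq> A \<and> finite F \<and> card F = Suc n}
        \<subseteq> case_prod insert ` (A \<times> {F. F \<subseteq> A \<and> finite F \<and> card F = n})"
    proof clarify
      fix F assume "F \<subseteq> A" "finite F" "card F = Suc n"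
      then obtain x G where "F = insert x G" "x \<notin> G" "card G = n"
        by (meson card_Suc_eq)
      then show "F \<in> case_prod insert ` (A \<times> {F. F \<subseteq> A \<and> finite F \<and> card F = n})"
        using \<open>F \<subseteq> A\<close> \<open>finite F\<close> by force
    qed
    moreover have "|case_prod insert ` (A \<times> {F. F \<subseteq> A \<and> finite F \<and> card F = n})| <o \<kappa>"
      by (intro small_image small_Times assms Suc)
    ultimately show ?case
      by (rule small_mono[rotated])
  qed
  have "|\<Union>n::nat. {F. F \<subseteq> A \<and> finite F \<and> card F = n}| <o \<kappa>"
    using * by (intro small_UN small_countable)
  then show ?thesis
    by (rule small_mono) (auto simp: Fpow_def)
qed

section \<open>Bounds, successors and suprema of small sets\<close>

lemma cofinality_le:
  assumes "A \<subseteq> Field r" and "unbounded_in r A B"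
  shows "cofinality r A \<le>o |B|"
  using cofinality_least[OF Well_order assms(1)] assms(2) by metis

text \<open>A set of size less than \<kappa> cannot be unbounded in \<lambda>, whose cofinality is
  at least \<kappa>.\<close>

lemma bounded:
  assumes "A \<subseteq> Field r" and "|A| <o \<kappa>"
  obtains \<beta> where "\<beta> \<in> Field r" and "A \<subseteq> underS r \<beta>"
proof -
  have "\<not> unbounded_in r (Field r) A"
  proof
    assume "unbounded_in r (Field r) A"
    then have "cofinality r (Field r) \<le>o |A|"
      by (rule cofinality_le[OF order_refl])
    from ordLeq_ordLess_trans[OF ordLeq_transitive[OF le_cofinality this] assms(2)]
    show False
      by (simp add: ordLess_irreflexive)
  qed
  then obtain \<beta> where "\<beta> \<in> Field r" "\<forall>x\<in>A. (\<beta>, x) \<notin> r"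
    using assms(1) unfolding unbounded_in_def by blast
  then show thesis
    using that assms(1) total unfolding le_iff by blast
qed

text \<open>The ordinal successor x + 1. It exists for x in \<open>Field r\<close> because
  \<open>bounded\<close>, applied to {x}, rules out a maximum.\<close>

definition next_elt :: "'a \<Rightarrow> 'a" where
  "next_elt x = (SOME y. x \<prec> y \<and> (\<forall>z. x \<prec> z \<longrightarrow> \<not> z \<prec> y))"

lemma next_elt:
  assumes "x \<in> Field r"
  shows "x \<prec> next_elt x" and "x \<prec> z \<Longrightarrow> \<not> z \<prec> next_elt x"
proof -
  obtain \<beta> where "x \<prec> \<beta>"
    using bounded[of "{x}"] assms small_finite[of "{x}"] by auto
  then obtain m where "x \<prec> m" "\<And>z. z \<prec> m \<Longrightarrow> \<not> x \<prec> z"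
    using least[of "\<lambda>y. x \<prec> y" \<beta>] less_Field by auto
  then have "\<exists>y. x \<prec> y \<and> (\<forall>z. x \<prec> z \<longrightarrow> \<not> z \<prec> y)"
    by blast
  from someI_ex[OF this] show "x \<prec> next_elt x" "x \<prec> z \<Longrightarrow> \<not> z \<prec> next_elt x"
    unfolding next_elt_def by blast+
qed

lemma next_elt_less_limit:
  assumes "\<delta> \<in> limit_ordinals r" and "x \<prec> \<delta>"
  shows "next_elt x \<prec> \<delta>"
proof -
  obtain y where "x \<prec> y" "y \<prec> \<delta>"
    using assms unfolding limit_ordinals_def by blast
  then show ?thesis
    using next_elt[of x] less_Field total[of "next_elt x" y] trans by metis
qed

text \<open>The supremum of a set without maximum. Membership in the index set of the square
  sequence is built in, so that \<open>\<C> \<alpha>\<close> is meaningful.\<close>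

definition is_sup :: "'a set \<Rightarrow> 'a \<Rightarrow> bool" where
  "is_sup a \<alpha> \<longleftrightarrow> \<alpha> \<in> limit_ordinals r \<inter> cof_less \<kappa> r \<and> unbounded_in r (underS r \<alpha>) a"

lemma limit_pointsD: "\<beta> \<in> limit_points r C \<Longrightarrow> x \<prec> \<beta> \<Longrightarrow> \<exists>y\<in>C. x \<prec> y \<and> y \<prec> \<beta>"
  by (auto simp: limit_points_def)

lemma underS_subset: "underS r \<alpha> \<subseteq> Field r"
  using less_Field by blast

lemma cof_lessI:
  assumes "\<alpha> \<in> Field r" and "unbounded_in r (underS r \<alpha>) B" and "|B| <o \<kappa>"
  shows "\<alpha> \<in> cof_less \<kappa> r"
  using ordLeq_ordLess_trans[OF cofinality_le[OF underS_subset assms(2)] assms(3)] assms(1)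
  unfolding cof_less_def by blast

text \<open>Take the least strict upper bound of \<open>a\<close>. It is a limit since
  \<open>a\<close> has no maximum, and \<open>a\<close> itself witnesses that its cofinality is less
  than \<kappa>.\<close>

lemma ex_is_sup:
  assumes "a \<subseteq> Field r" and "|a| <o \<kappa>" and "a \<noteq> {}" and "\<And>x. x \<in> a \<Longrightarrow> \<exists>y\<in>a. x \<prec> y"
  shows "\<exists>\<alpha>. is_sup a \<alpha>"
proof -
  obtain \<beta> where \<beta>: "\<beta> \<in> Field r" "a \<subseteq> underS r \<beta>"
    using bounded[OF assms(1,2)] .
  obtain \<alpha> where \<alpha>: "\<alpha> \<in> Field r" "a \<subseteq> underS r \<alpha>"
    "\<And>x. x \<prec> \<alpha> \<Longrightarrow> \<not> a \<subseteq> underS r x"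
    using least[of "\<lambda>x. a \<subseteq> underS r x", OF \<beta>(2,1)] by metis
  have *: "\<exists>y\<in>a. x \<prec> y" if x: "x \<prec> \<alpha>" for x
  proof -
    obtain y where "y \<in> a" "\<not> y \<prec> x"
      using \<alpha>(3)[OF x] less_Field[OF x] by blast
    then show ?thesis
      using assms(1,4) total[of x y] less_Field[OF x] by blast
  qed
  then have "unbounded_in r (underS r \<alpha>) a"
    using \<alpha>(2) less_Field unfolding unbounded_in_def le_iff by blast
  moreover from this have "\<alpha> \<in> cof_less \<kappa> r"
    using cof_lessI \<alpha>(1) assms(2) by blast
  moreover have "\<alpha> \<in> limit_ordinals r"
    using * \<alpha>(1,2) assms(3) unfolding limit_ordinals_def by blast
  ultimately show ?thesis
    unfolding is_sup_def by blast
qed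

lemma is_sup_less: "is_sup a \<alpha> \<Longrightarrow> x \<prec> \<alpha> \<Longrightarrow> \<exists>y\<in>a. x \<prec> y \<and> y \<prec> \<alpha>"
  unfolding is_sup_def limit_ordinals_def unbounded_in_def le_iff
  by (smt (verit, ccfv_SIG) IntD1 mem_Collect_eq subsetD trans)

section \<open>Clubs in P_\<kappa>\<lambda>\<close>

lemma Pk_UN_chain:
  assumes "\<gamma> \<in> Field \<kappa>" and "f ` underS \<kappa> \<gamma> \<subseteq> Pk \<kappa> r"
  shows "\<Union> (f ` underS \<kappa> \<gamma>) \<in> Pk \<kappa> r"
proof -
  have "|\<Union> (f ` underS \<kappa> \<gamma>)| <o \<kappa>"
    using assms card_of_underS[OF Card_order] unfolding Pk_def by (intro small_UN) auto
  then show ?thesis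
    using assms(2) unfolding Pk_def by blast
qed

lemma Pk_club_Pk: "Pk_club \<kappa> r (Pk \<kappa> r)"
  unfolding Pk_club_def by (auto intro: Pk_UN_chain)

text \<open>Closing off under F takes countably many steps, each adding a small set, so the closure
  is still small. Unions of chains preserve the condition because F acts on single points.\<close>

lemma Pk_club_closed:
  assumes F: "\<And>x. x \<in> Field r \<Longrightarrow> F x \<subseteq> Field r \<and> finite (F x)" and "B \<in> Pk \<kappa> r"
  shows "Pk_club \<kappa> r {a \<in> Pk \<kappa> r. B \<subseteq> a \<and> (\<forall>x\<in>a. F x \<subseteq> a)}"
  unfolding Pk_club_def
proof (intro conjI ballI allI impI)
  fix a assume a: "a \<in> Pk \<kappa> r"
  define A where "A n = ((\<lambda>b. b \<union> \<Union> (F ` b)) ^^ n) (a \<union> B)" for n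
  have A_Suc: "A (Suc n) = A n \<union> \<Union> (F ` A n)" for n
    by (simp add: A_def)
  have "A n \<subseteq> Field r \<and> |A n| <o \<kappa>" for n
  proof (induction n)
    case 0
    then show ?case
      using a \<open>B \<in> Pk \<kappa> r\<close> small_Un unfolding A_def Pk_def by auto
  next
    case (Suc n)
    then have "|\<Union> (F ` A n)| <o \<kappa>"
      using F by (intro small_UN) (auto intro: small_finite)
    then show ?case
      using Suc F small_Un unfolding A_Suc by auto
  qed
  then have "(\<Union>n. A n) \<in> Pk \<kappa> r"
    unfolding Pk_def by (auto intro: small_UN small_countable)
  moreover have "a \<union> B \<subseteq> (\<Union>n. A n)"
    using UN_upper[of 0 UNIV A] unfolding A_def by simp
  moreover have "F x \<subseteq> (\<Union>n. A n)" if "x \<in> A n" for x n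
    using that A_Suc[of n] by blast
  ultimately show "\<exists>c\<in>{a \<in> Pk \<kappa> r. B \<subseteq> a \<and> (\<forall>x\<in>a. F x \<subseteq> a)}. a \<subseteq> c"
    by (intro bexI[of _ "\<Union>n. A n"] CollectI conjI ballI) (simp, simp, simp, blast)
next
  fix \<gamma> f
  assume \<gamma>: "\<gamma> \<in> Field \<kappa>"
    and f: "underS \<kappa> \<gamma> \<noteq> {} \<and> f ` underS \<kappa> \<gamma> \<subseteq> {a \<in> Pk \<kappa> r. B \<subseteq> a \<and> (\<forall>x\<in>a. F x \<subseteq> a)} \<and>
      (\<forall>\<xi>\<in>underS \<kappa> \<gamma>. \<forall>\<eta>\<in>underS \<kappa> \<gamma>. (\<xi>, \<eta>) \<in> \<kappa> \<longrightarrow> f \<xi> \<subseteq> f \<eta>)"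
  then have "\<Union> (f ` underS \<kappa> \<gamma>) \<in> Pk \<kappa> r"
    by (intro Pk_UN_chain) auto
  moreover have "B \<subseteq> \<Union> (f ` underS \<kappa> \<gamma>)"
    using f by fast
  moreover have "\<forall>x\<in>\<Union> (f ` underS \<kappa> \<gamma>). F x \<subseteq> \<Union> (f ` underS \<kappa> \<gamma>)"
    using f by fast
  ultimately show "\<Union> (f ` underS \<kappa> \<gamma>) \<in> {a \<in> Pk \<kappa> r. B \<subseteq> a \<and> (\<forall>x\<in>a. F x \<subseteq> a)}"
    by blast
qed blast

subsection \<open>Thinness\<close>

text \<open>The interval is half-open, so that for y = x + 1 the answer decides whether x belongs to
  C.\<close>

definition meets :: "'a set \<Rightarrow> 'a \<Rightarrow> 'a \<Rightarrow> bool" where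
  "meets C x y \<longleftrightarrow> (\<exists>\<xi>\<in>C. (x, \<xi>) \<in> r \<and> \<xi> \<prec> y)"

text \<open>The last clause makes y the least point of B strictly above \<xi>.\<close>

definition next_in :: "'a set \<Rightarrow> 'a set \<Rightarrow> 'a set" where
  "next_in B C = {y \<in> B. \<exists>\<xi>\<in>C. \<xi> \<prec> y \<and> (\<forall>w\<in>B. w \<prec> y \<longrightarrow> (w, \<xi>) \<in> r)}"

text \<open>If \<xi> in C lies in [x, y), the least point of B above \<xi> lies in (x, y].
  Conversely, if z in (x, y] is the next point of B above \<xi>, then x in B and x \<prec> z force x
  to be at most \<xi>.\<close>

lemma meets_iff_next_in:
  assumes "B \<subseteq> Field r" and "x \<in> B" and "y \<in> B"
  shows "meets C x y \<longleftrightarrow> (\<exists>z\<in>next_in B C. x \<prec> z \<and> (z, y) \<in> r)"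
proof
  assume "meets C x y"
  then obtain \<xi> where \<xi>: "\<xi> \<in> C" "(x, \<xi>) \<in> r" "\<xi> \<prec> y"
    unfolding meets_def by blast
  then obtain z where z: "z \<in> B" "\<xi> \<prec> z" "\<And>w. w \<prec> z \<Longrightarrow> \<not> (w \<in> B \<and> \<xi> \<prec> w)"
    using least[of "\<lambda>z. z \<in> B \<and> \<xi> \<prec> z" y] assms by (metis subsetD)
  have "z \<in> next_in B C"
    using z \<xi> assms(1) total less_Field unfolding next_in_def le_iff by blast
  moreover have "x \<prec> z"
    using \<xi>(2) z(2) trans unfolding le_iff by blast
  moreover have "(z, y) \<in> r"
    using z \<xi>(3) assms total unfolding le_iff by blast
  ultimately show "\<exists>z\<in>next_in B C. x \<prec> z \<and> (z, y) \<in> r"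
    by blast
next
  assume "\<exists>z\<in>next_in B C. x \<prec> z \<and> (z, y) \<in> r"
  then obtain z \<xi> where "x \<prec> z" "(z, y) \<in> r" "\<xi> \<in> C" "\<xi> \<prec> z" "(x, \<xi>) \<in> r"
    using assms(2) unfolding next_in_def by blast
  then show "meets C x y"
    unfolding meets_def le_iff using trans by blast
qed

lemma limit_points_mono: "A \<subseteq> B \<Longrightarrow> limit_points r A \<subseteq> limit_points r B"
  unfolding limit_points_def by blast

text \<open>The two sets interleave: between any two points of \<open>next_in B C\<close> there is a
  point of C, possibly equal to the lower one.\<close>

lemma limit_points_next_in:
  assumes "\<delta> \<in> limit_points r (next_in B C)"
  shows "\<delta> \<in> limit_points r B" and "\<delta> \<in> limit_points r C"
proof -
  show "\<delta> \<in> limit_points r B"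
    using assms limit_points_mono[of "next_in B C" B] unfolding next_in_def by blast
  have "\<exists>\<xi>\<in>C. x \<prec> \<xi> \<and> \<xi> \<prec> \<delta>" if x: "x \<prec> \<delta>" for x
  proof -
    obtain y where y: "y \<in> next_in B C" "x \<prec> y" "y \<prec> \<delta>"
      using limit_pointsD[OF assms x] by blast
    then obtain z where z: "z \<in> next_in B C" "y \<prec> z" "z \<prec> \<delta>"
      using limit_pointsD[OF assms] by blast
    then obtain \<xi> where "\<xi> \<in> C" "\<xi> \<prec> z" "(y, \<xi>) \<in> r"
      using y(1) unfolding next_in_def by blast
    then show ?thesis
      using y(2) z(3) trans unfolding le_iff by blast
  qed
  then show "\<delta> \<in> limit_points r C"
    using assms unfolding limit_points_def by blast
qed

text \<open>This allows coherence to be applied at every limit point of a small set.\<close>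

lemma limit_point_cof_less:
  assumes "|B| <o \<kappa>" and "\<delta> \<in> limit_points r B"
  shows "\<delta> \<in> limit_ordinals r \<inter> cof_less \<kappa> r"
proof -
  have "unbounded_in r (underS r \<delta>) (B \<inter> underS r \<delta>)"
    using limit_pointsD[OF assms(2)] less_Field unfolding unbounded_in_def le_iff by blast
  then have "\<delta> \<in> cof_less \<kappa> r"
    using cof_lessI small_mono[OF assms(1)] assms(2) unfolding limit_points_def by blast
  then show ?thesis
    using assms(2) unfolding limit_points_def limit_ordinals_def by blast
qed

text \<open>Choose \<gamma> least such that only finitely many points of N are not below \<gamma>.
  If N had no point strictly between some x \<prec> \<gamma> and \<gamma>, passing from \<gamma> to
  x would add at most the point x, against minimality.\<close>

lemma finite_above_limit_point:
  assumes "N \<subseteq> underS r \<beta>" and "infinite N" and "\<beta> \<in> Field r"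
  obtains \<gamma> where "\<gamma> \<in> limit_points r N" and "finite {y \<in> N. \<not> y \<prec> \<gamma>}"
proof -
  have "{y \<in> N. \<not> y \<prec> \<beta>} = {}"
    using assms(1) by blast
  then have "finite {y \<in> N. \<not> y \<prec> \<beta>}"
    by (simp only: finite.emptyI)
  then obtain \<gamma> where \<gamma>: "\<gamma> \<in> Field r" "finite {y \<in> N. \<not> y \<prec> \<gamma>}"
    and min: "\<And>x. x \<prec> \<gamma> \<Longrightarrow> infinite {y \<in> N. \<not> y \<prec> x}"
    using least[of "\<lambda>\<gamma>. finite {y \<in> N. \<not> y \<prec> \<gamma>}", OF _ assms(3)] by blast
  have "underS r \<gamma> \<noteq> {}"
    using \<gamma>(2) assms(2) by auto
  moreover have "\<exists>y\<in>N. x \<prec> y \<and> y \<prec> \<gamma>" if x: "x \<prec> \<gamma>" for x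
  proof (rule ccontr)
    assume "\<not> ?thesis"
    then have "{y \<in> N. \<not> y \<prec> x} \<subseteq> insert x {y \<in> N. \<not> y \<prec> \<gamma>}"
      using total[of x] less_Field[OF x] assms(1) less_Field by blast
    then show False
      using min[OF x] \<gamma>(2) less_Field[OF x] by (meson finite_insert finite_subset)
  qed
  ultimately have "\<gamma> \<in> limit_points r N"
    using \<gamma>(1) unfolding limit_points_def by blast
  then show thesis
    using that \<gamma>(2) by blast
qed

text \<open>A limit point \<gamma> is determined by the part of B below it. That part is B itself or
  the part of B below v, for v the least point of B not below \<gamma>, which leaves fewer than
  \<kappa> possibilities.\<close>

lemma small_limit_points:
  assumes "B \<subseteq> Field r" and "|B| <o \<kappa>"
  shows "|limit_points r B| <o \<kappa>"
proof -
  have *: "B \<inter> underS r \<gamma> \<noteq> B \<inter> underS r \<gamma>'"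
    if "\<gamma>' \<in> limit_points r B" "\<gamma> \<prec> \<gamma>'" for \<gamma> \<gamma>'
    using limit_pointsD[OF that] trans irrefl by blast
  have "inj_on (\<lambda>\<gamma>. B \<inter> underS r \<gamma>) (limit_points r B)"
  proof (rule inj_onI, rule ccontr)
    fix \<gamma> \<gamma>'
    assume "\<gamma> \<in> limit_points r B" "\<gamma>' \<in> limit_points r B" "\<gamma> \<noteq> \<gamma>'"
      and "B \<inter> underS r \<gamma> = B \<inter> underS r \<gamma>'"
    then show False
      using * total[of \<gamma> \<gamma>'] unfolding limit_points_def by (smt (verit) mem_Collect_eq)
  qed
  moreover have "B \<inter> underS r \<gamma> \<in> {B} \<union> (\<lambda>v. B \<inter> underS r v) ` B" if "\<gamma> \<in> Field r" for \<gamma>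
  proof (cases "B \<subseteq> underS r \<gamma>")
    case False
    then obtain u where "u \<in> B \<and> \<not> u \<prec> \<gamma>" "u \<in> Field r"
      using assms(1) by blast
    then obtain v where v: "v \<in> B" "\<not> v \<prec> \<gamma>" "\<And>w. w \<prec> v \<Longrightarrow> \<not> (w \<in> B \<and> \<not> w \<prec> \<gamma>)"
      using least[of "\<lambda>v. v \<in> B \<and> \<not> v \<prec> \<gamma>" u] by metis
    have "B \<inter> underS r \<gamma> = B \<inter> underS r v"
      using v total[of v \<gamma>] assms(1) that trans by blast
    then show ?thesis
      using v(1) by blast
  qed blast
  then have "(\<lambda>\<gamma>. B \<inter> underS r \<gamma>) ` limit_points r B \<subseteq> {B} \<union> (\<lambda>v. B \<inter> underS r v) ` B"
    unfolding limit_points_def by blast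
  ultimately have "|limit_points r B| \<le>o |{B} \<union> (\<lambda>v. B \<inter> underS r v) ` B|"
    using card_of_ordLeq by blast
  moreover have "|{B} \<union> (\<lambda>v. B \<inter> underS r v) ` B| <o \<kappa>"
    by (intro small_Un small_image assms(2) small_finite[of "{B}"]) simp
  ultimately show ?thesis
    by (rule ordLeq_ordLess_trans)
qed

text \<open>For y \<prec> \<gamma> the witness \<xi> in C lies below y and hence below
  \<gamma>.\<close>

lemma next_in_initial:
  "next_in B C = next_in B (C \<inter> underS r \<gamma>) \<union> {y \<in> next_in B C. \<not> y \<prec> \<gamma>}"
  using trans unfolding next_in_def by blast

end

locale square_setting = regular_le_cofinality \<kappa> r
  for \<kappa> :: "'b rel" and r :: "'a rel" +
  fixes \<C> :: "'a \<Rightarrow> 'a set set"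
  assumes square: "square_sequence (cof_less \<kappa> r) \<kappa> r \<C>"
begin

abbreviation index :: "'a set" where
  "index \<equiv> limit_ordinals r \<inter> cof_less \<kappa> r"

lemma small_C: "\<alpha> \<in> index \<Longrightarrow> |\<C> \<alpha>| <o \<kappa>"
  and nonempty_C: "\<alpha> \<in> index \<Longrightarrow> \<C> \<alpha> \<noteq> {}"
  and club_C: "\<alpha> \<in> index \<Longrightarrow> C \<in> \<C> \<alpha> \<Longrightarrow> club_in r (underS r \<alpha>) C"
  and coherent: "\<alpha> \<in> index \<Longrightarrow> C \<in> \<C> \<alpha> \<Longrightarrow> \<beta> \<in> limit_points r C \<inter> cof_less \<kappa> r
    \<Longrightarrow> C \<inter> underS r \<beta> \<in> \<C> \<beta>"
  and no_thread: "club_in r (Field r) D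
    \<Longrightarrow> \<not> (\<forall>\<delta>\<in>limit_points r D \<inter> cof_less \<kappa> r. D \<inter> underS r \<delta> \<in> \<C> \<delta>)"
  using square unfolding square_sequence_def by blast+

text \<open>Each value is \<open>next_in B X\<close> together with a finite subset of B, where X is
  empty or belongs to \<open>\<C> \<gamma>\<close> for a limit point \<gamma> of B. There are fewer
  than \<kappa> such pairs.\<close>

lemma small_next_in:
  assumes "B \<subseteq> Field r" and "|B| <o \<kappa>"
  shows "|next_in B ` ({{}} \<union> (\<Union>\<alpha>\<in>index. \<C> \<alpha>))| <o \<kappa>"
proof -
  let ?L = "(\<Union>\<gamma>\<in>limit_points r B. \<C> \<gamma>)"
  have "next_in B C \<in> (\<lambda>(X, F). next_in B X \<union> F) ` (({{}} \<union> ?L) \<times> Fpow B)"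
    if C: "C \<in> {{}} \<union> (\<Union>\<alpha>\<in>index. \<C> \<alpha>)" for C
  proof (cases "finite (next_in B C)")
    case True
    then have "next_in B C \<in> Fpow B"
      unfolding Fpow_def next_in_def by blast
    moreover have "next_in B C = (\<lambda>(X, F). next_in B X \<union> F) ({}, next_in B C)"
      by (simp add: next_in_def)
    ultimately show ?thesis
      by blast
  next
    case False
    have "next_in B C \<subseteq> B"
      unfolding next_in_def by blast
    moreover obtain \<beta> where "\<beta> \<in> Field r" "B \<subseteq> underS r \<beta>"
      using bounded assms by blast
    ultimately obtain \<gamma> where \<gamma>: "\<gamma> \<in> limit_points r (next_in B C)"
      and fin: "finite {y \<in> next_in B C. \<not> y \<prec> \<gamma>}"
      using finite_above_limit_point[of "next_in B C" \<beta>] False by blast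
    \<comment> \<open>This excludes the default value {}, so that C comes from the square sequence
      and coherence applies at \<gamma>.\<close>
    have "C \<noteq> {}"
      using False by (auto simp: next_in_def)
    then have "C \<inter> underS r \<gamma> \<in> \<C> \<gamma>"
      using C coherent limit_points_next_in[OF \<gamma>] limit_point_cof_less[OF assms(2)] by blast
    moreover have "{y \<in> next_in B C. \<not> y \<prec> \<gamma>} \<in> Fpow B"
      using fin unfolding Fpow_def next_in_def by blast
    moreover have "next_in B C = (\<lambda>(X, F). next_in B X \<union> F)
        (C \<inter> underS r \<gamma>, {y \<in> next_in B C. \<not> y \<prec> \<gamma>})"
      using next_in_initial by simp
    ultimately show ?thesis
      using limit_points_next_in(1)[OF \<gamma>] by blast
  qed
  moreover have "|({{}} \<union> ?L) \<times> Fpow B| <o \<kappa>"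
    using small_limit_points[OF assms] small_C limit_point_cof_less[OF assms(2)] assms(2)
    by (intro small_Times small_Un small_UN small_Fpow) (auto intro: small_finite)
  ultimately show ?thesis
    using small_mono[OF small_image] by (metis (no_types, lifting) image_subsetI)
qed

text \<open>With B the set of all endpoints, the answers factor through \<open>next_in B C\<close>,
  which takes fewer than \<kappa> values.\<close>

lemma small_answers:
  assumes "|c| <o \<kappa>" and "f ` c \<subseteq> Field r" and "g ` c \<subseteq> Field r"
  shows "|(\<lambda>C. {z \<in> c. meets C (f z) (g z)}) ` ({{}} \<union> (\<Union>\<alpha>\<in>index. \<C> \<alpha>))| <o \<kappa>"
proof -
  let ?B = "f ` c \<union> g ` c"
  let ?h = "\<lambda>N. {z \<in> c. \<exists>y\<in>N. f z \<prec> y \<and> (y, g z) \<in> r}"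
  have "(\<lambda>C. {z \<in> c. meets C (f z) (g z)}) = (\<lambda>C. ?h (next_in ?B C))"
    using meets_iff_next_in[of ?B] assms(2,3) by (intro ext Collect_cong) auto
  moreover have "|?h ` next_in ?B ` ({{}} \<union> (\<Union>\<alpha>\<in>index. \<C> \<alpha>))| <o \<kappa>"
    using assms by (intro small_image small_next_in small_Un) auto
  ultimately show ?thesis
    by (simp only: image_image)
qed

subsection \<open>Threading the square sequence\<close>

text \<open>Here Q x y stands for the answer of a branch at the code of (x, y). The first premise
  turns E into a local member of the square sequence, and the second supplies the positive answers
  that make E unbounded.\<close>

lemma no_uniform_answers:
  assumes local: "\<And>P. P \<subseteq> Field r \<times> Field r \<Longrightarrow> |P| <o \<kappa> \<Longrightarrow>
      \<exists>\<alpha>\<in>index. \<exists>C\<in>\<C> \<alpha>. \<forall>(x, y)\<in>P. Q x y \<longleftrightarrow> meets C x y"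
    and unbounded: "\<And>x. x \<in> Field r \<Longrightarrow> \<exists>y\<in>Field r. Q x y"
  shows False
proof -
  define E where "E = {\<xi> \<in> Field r. Q \<xi> (next_elt \<xi>)}"
  \<comment> \<open>The condition \<open>lim\<close> makes intervals with positive answers cofinal
    in \<delta>, which forces a club agreeing with Q on them to accumulate at \<delta>.\<close>
  have thread: "E \<inter> underS r \<delta> \<in> \<C> \<delta>"
    if \<delta>: "\<delta> \<in> index" and lim: "\<And>x. x \<prec> \<delta> \<Longrightarrow> \<exists>x' y. x \<prec> x' \<and> y \<prec> \<delta> \<and> x' \<in> Field r \<and> Q x' y" for \<delta>
  proof -
    obtain B where B: "unbounded_in r (underS r \<delta>) B" "|B| <o \<kappa>"
      using cofinality_least[OF Well_order underS_subset, of \<delta>] \<delta> unfolding cof_less_def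
      by (metis (no_types, lifting) IntD2 mem_Collect_eq)
    have "\<forall>x\<in>B. \<exists>p. x \<prec> fst p \<and> snd p \<prec> \<delta> \<and> Q (fst p) (snd p)"
      using lim B(1) unfolding unbounded_in_def by fastforce
    then obtain g where g: "\<And>x. x \<in> B \<Longrightarrow> x \<prec> fst (g x) \<and> snd (g x) \<prec> \<delta> \<and> Q (fst (g x)) (snd (g x))"
      by metis
    define bad where
      "bad X p \<longleftrightarrow> fst p \<prec> \<delta> \<and> snd p \<prec> \<delta> \<and> Q (fst p) (snd p) \<noteq> meets X (fst p) (snd p)" for X p
    define h where "h X = (SOME p. bad X p)" for X
    have h: "bad X (h X)" if "bad X p" for X p
      unfolding h_def using that by (rule someI)
    have h_Field: "h X \<in> Field r \<times> Field r" if "bad X (h X)" for X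
      using that less_Field unfolding bad_def by (auto simp: mem_Times_iff)
    \<comment> \<open>Two kinds of test pairs: positive answers cofinal in \<delta>, and one
      counterexample for each member of \<open>\<C> \<delta>\<close> that disagrees with Q below
      \<delta>.\<close>
    define P where "P = g ` B \<union> h ` {X \<in> \<C> \<delta>. bad X (h X)}"
    have "P \<subseteq> Field r \<times> Field r"
      unfolding P_def
    proof (intro Un_least image_subsetI)
      show "g x \<in> Field r \<times> Field r" if "x \<in> B" for x
        using g[OF that] less_Field by (auto simp: mem_Times_iff)
    qed (use h_Field in blast)
    moreover have "|P| <o \<kappa>"
      unfolding P_def using B(2) small_C[OF \<delta>]
      by (intro small_Un small_image) (auto intro: small_mono)
    ultimately obtain \<alpha> C where C: "\<alpha> \<in> index" "C \<in> \<C> \<alpha>"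
      and agree: "\<And>p. p \<in> P \<Longrightarrow> Q (fst p) (snd p) \<longleftrightarrow> meets C (fst p) (snd p)"
      using local[of P] by fastforce
    have "\<exists>\<zeta>\<in>C. x \<prec> \<zeta> \<and> \<zeta> \<prec> \<delta>" if x: "x \<prec> \<delta>" for x
    proof -
      obtain b where b: "b \<in> B" "(x, b) \<in> r"
        using B(1) x unfolding unbounded_in_def by blast
      then have "meets C (fst (g b)) (snd (g b))"
        using agree[of "g b"] g[of b] unfolding P_def by blast
      then show ?thesis
        using b g[of b] trans unfolding meets_def le_iff by metis
    qed
    then have "\<delta> \<in> limit_points r C"
      using \<delta> unfolding limit_points_def limit_ordinals_def by blast
    then have X: "C \<inter> underS r \<delta> \<in> \<C> \<delta>"
      using coherent C \<delta> by blast
    have C_X: "meets (C \<inter> underS r \<delta>) x y \<longleftrightarrow> meets C x y" if "y \<prec> \<delta>" for x y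
      using that trans unfolding meets_def by blast
    \<comment> \<open>By coherence this initial segment is itself in \<open>\<C> \<delta>\<close>.
      If it disagreed with Q, its own counterexample would lie in P, where C agrees with Q.\<close>
    have "\<not> bad (C \<inter> underS r \<delta>) (h (C \<inter> underS r \<delta>))"
      using agree[of "h (C \<inter> underS r \<delta>)"] X C_X unfolding P_def bad_def by blast
    then have Q: "Q x y \<longleftrightarrow> meets C x y" if "x \<prec> \<delta>" "y \<prec> \<delta>" for x y
      using h[of "C \<inter> underS r \<delta>" "(x, y)"] that C_X unfolding bad_def by auto
    have "\<xi> \<in> E \<longleftrightarrow> \<xi> \<in> C" if \<xi>: "\<xi> \<prec> \<delta>" for \<xi>
    proof -
      have "next_elt \<xi> \<prec> \<delta>"
        using next_elt_less_limit \<delta> \<xi> by blast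
      then have "\<xi> \<in> E \<longleftrightarrow> meets C \<xi> (next_elt \<xi>)"
        using Q \<xi> less_Field[OF \<xi>] unfolding E_def by blast
      also have "\<dots> \<longleftrightarrow> \<xi> \<in> C"
        using next_elt[of \<xi>] less_Field[OF \<xi>] unfolding meets_def le_iff by blast
      finally show ?thesis .
    qed
    then have "E \<inter> underS r \<delta> = C \<inter> underS r \<delta>"
      by blast
    then show ?thesis
      using X by simp
  qed
  have Q_less: "x \<prec> y" if "Q x y" "x \<in> Field r" "y \<in> Field r" for x y
  proof -
    have "\<exists>C. meets C x y"
      using local[of "{(x, y)}"] that small_finite[of "{(x, y)}"] by auto
    then show ?thesis
      unfolding meets_def le_iff using trans by blast
  qed
  \<comment> \<open>Starting from \<xi>, answers are iterated \<omega> times: the interval from s(n)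
    + 1 to s(n + 1) has a positive answer. The supremum \<delta> then satisfies the hypotheses of
    \<open>thread\<close>.\<close>
  have above: "\<exists>\<delta>. \<xi> \<prec> \<delta> \<and> \<delta> \<in> index \<and> E \<inter> underS r \<delta> \<in> \<C> \<delta>" if \<xi>: "\<xi> \<in> Field r" for \<xi>
  proof -
    have "\<forall>x\<in>Field r. \<exists>y\<in>Field r. Q (next_elt x) y"
      using unbounded next_elt(1) less_Field by blast
    then obtain f where f: "\<And>x. x \<in> Field r \<Longrightarrow> f x \<in> Field r \<and> Q (next_elt x) (f x)"
      by metis
    have f_less: "x \<prec> f x" if "x \<in> Field r" for x
      using that f Q_less next_elt(1) less_Field trans by meson
    define s where "s n = (f ^^ n) \<xi>" for n
    have s: "s n \<in> Field r" for n
      by (induction n) (use \<xi> f in \<open>auto simp: s_def\<close>)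
    have s_Suc: "s (Suc n) = f (s n)" for n
      by (simp add: s_def)
    have "\<exists>\<delta>. is_sup (range s) \<delta>"
    proof (rule ex_is_sup)
      show "range s \<subseteq> Field r" "range s \<noteq> {}"
        using s by auto
      show "|range s| <o \<kappa>"
        by (rule small_image[OF small_countable])
      show "\<exists>y\<in>range s. x \<prec> y" if "x \<in> range s" for x
        using that f_less s s_Suc by (metis imageE rangeI)
    qed
    then obtain \<delta> where \<delta>: "is_sup (range s) \<delta>"
      by blast
    then have s_less: "s n \<prec> \<delta>" for n
      unfolding is_sup_def unbounded_in_def by blast
    have "E \<inter> underS r \<delta> \<in> \<C> \<delta>"
    proof (rule thread)
      show "\<delta> \<in> index"
        using \<delta> unfolding is_sup_def by blast
      fix x assume "x \<prec> \<delta>"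
      then obtain n where "x \<prec> s n"
        using is_sup_less[OF \<delta>] by blast
      then have "x \<prec> next_elt (s n) \<and> s (Suc n) \<prec> \<delta> \<and> next_elt (s n) \<in> Field r
          \<and> Q (next_elt (s n)) (s (Suc n))"
        using next_elt(1)[OF s] trans less_Field s_less f[OF s] s_Suc by metis
      then show "\<exists>x' y. x \<prec> x' \<and> y \<prec> \<delta> \<and> x' \<in> Field r \<and> Q x' y"
        by blast
    qed
    then show ?thesis
      using s_less[of 0] \<delta> unfolding s_def is_sup_def by auto
  qed
  \<comment> \<open>Every point of \<lambda> lies below some \<delta> at which the initial segment
    of E is in \<open>\<C> \<delta>\<close>, hence club in \<delta>. Unboundedness and closure of E
    are read off there.\<close>
  have "unbounded_in r (Field r) E"
    unfolding unbounded_in_def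
  proof (intro conjI ballI)
    fix \<xi> assume "\<xi> \<in> Field r"
    then obtain \<delta> where "\<xi> \<prec> \<delta>" "\<delta> \<in> index" "E \<inter> underS r \<delta> \<in> \<C> \<delta>"
      using above by blast
    then show "\<exists>\<eta>\<in>E. (\<xi>, \<eta>) \<in> r"
      using club_C unfolding club_in_def unbounded_in_def by (meson IntD1)
  qed (auto simp: E_def)
  moreover have "limit_points r E \<inter> Field r \<subseteq> E"
  proof
    fix \<gamma> assume \<gamma>: "\<gamma> \<in> limit_points r E \<inter> Field r"
    then obtain \<delta> where \<delta>: "\<gamma> \<prec> \<delta>" "\<delta> \<in> index" "E \<inter> underS r \<delta> \<in> \<C> \<delta>"
      using above by blast
    have "\<gamma> \<in> limit_points r (E \<inter> underS r \<delta>)"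
      using \<gamma> \<delta>(1) trans unfolding limit_points_def by blast
    then show "\<gamma> \<in> E"
      using club_C[OF \<delta>(2,3)] \<delta>(1) unfolding club_in_def by blast
  qed
  ultimately have "club_in r (Field r) E"
    unfolding club_in_def by blast
  \<comment> \<open>The points x' of E below \<delta> supply the positive answers: Q x' (x' + 1)
    holds and x' + 1 is still below the limit \<delta>.\<close>
  moreover have "E \<inter> underS r \<delta> \<in> \<C> \<delta>" if \<delta>: "\<delta> \<in> limit_points r E \<inter> cof_less \<kappa> r" for \<delta>
  proof (rule thread)
    show "\<delta> \<in> index"
      using \<delta> unfolding limit_points_def limit_ordinals_def by blast
    then show "\<exists>x' y. x \<prec> x' \<and> y \<prec> \<delta> \<and> x' \<in> Field r \<and> Q x' y" if "x \<prec> \<delta>" for x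
      using limit_pointsD[of \<delta> E x] that \<delta> next_elt_less_limit unfolding E_def by blast
  qed
  ultimately show False
    using no_thread by blast
qed

section \<open>The list and its branch\<close>

theorem not_ITP:
  assumes "infinite (Field r)"
  shows "\<not> ITP \<kappa> r"
proof
  assume ITP: "ITP \<kappa> r"
  \<comment> \<open>Pairs are coded by single ordinals, since \<open>d a\<close> has to be a subset
    of \<open>a\<close>.\<close>
  obtain q where q: "bij_betw q (Field r) (Field r \<times> Field r)"
    using card_of_Times_same_infinite[OF assms] card_of_ordIso ordIso_symmetric by metis
  define p where "p x y = inv_into (Field r) q (x, y)" for x y
  have p: "p x y \<in> Field r" "q (p x y) = (x, y)" if "x \<in> Field r" "y \<in> Field r" for x y
    using that q unfolding p_def bij_betw_def by (auto intro: inv_into_into f_inv_into_f)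
  have q_Field: "fst (q z) \<in> Field r" "snd (q z) \<in> Field r" if "z \<in> Field r" for z
    using bij_betwE[OF q] that by (auto simp: mem_Times_iff)
  \<comment> \<open>The choice of the club for \<open>a\<close>, with {} as a possible value when
    \<open>a\<close> has no supremum in the sense of \<open>is_sup\<close>.\<close>
  have "\<exists>C. C \<in> {{}} \<union> (\<Union>\<alpha>\<in>index. \<C> \<alpha>) \<and> ((\<exists>\<alpha>. is_sup a \<alpha>) \<longrightarrow> (\<exists>\<alpha>. is_sup a \<alpha> \<and> C \<in> \<C> \<alpha>))" for a
    using nonempty_C unfolding is_sup_def by blast
  then obtain K where K: "\<And>a. K a \<in> {{}} \<union> (\<Union>\<alpha>\<in>index. \<C> \<alpha>)"
    and K_sup: "\<And>a \<alpha>. is_sup a \<alpha> \<Longrightarrow> \<exists>\<alpha>. is_sup a \<alpha> \<and> K a \<in> \<C> \<alpha>"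
    by metis
  define d where "d a = {z \<in> a. meets (K a) (fst (q z)) (snd (q z))}" for a
  \<comment> \<open>For c contained in \<open>a\<close>, the set \<open>d a \<inter> c\<close>
    consists of the codes in c at which \<open>K a\<close> answers positively. The bound holds for
    every c, so all of P_\<kappa>\<lambda> serves as the club.\<close>
  have "|{d a \<inter> c | a. a \<in> Pk \<kappa> r \<and> c \<subseteq> a}| <o \<kappa>" if c: "c \<in> Pk \<kappa> r" for c
  proof (rule small_mono)
    show "|(\<lambda>C. {z \<in> c. meets C (fst (q z)) (snd (q z))}) ` ({{}} \<union> (\<Union>\<alpha>\<in>index. \<C> \<alpha>))| <o \<kappa>"
      using c q_Field unfolding Pk_def by (intro small_answers) auto
    show "{d a \<inter> c | a. a \<in> Pk \<kappa> r \<and> c \<subseteq> a}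
        \<subseteq> (\<lambda>C. {z \<in> c. meets C (fst (q z)) (snd (q z))}) ` ({{}} \<union> (\<Union>\<alpha>\<in>index. \<C> \<alpha>))"
    proof
      fix s assume "s \<in> {d a \<inter> c | a. a \<in> Pk \<kappa> r \<and> c \<subseteq> a}"
      then obtain a where "s = d a \<inter> c" "c \<subseteq> a"
        by blast
      then have "s = {z \<in> c. meets (K a) (fst (q z)) (snd (q z))}"
        unfolding d_def by blast
      then show "s \<in> (\<lambda>C. {z \<in> c. meets C (fst (q z)) (snd (q z))}) ` ({{}} \<union> (\<Union>\<alpha>\<in>index. \<C> \<alpha>))"
        by (rule image_eqI[OF _ K])
    qed
  qed
  then have "thin \<kappa> r d"
    unfolding thin_def using Pk_club_Pk by blast
  moreover have "Pk_list \<kappa> r d"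
    unfolding Pk_list_def d_def by blast
  ultimately obtain D where D: "Pk_stationary \<kappa> r {a \<in> Pk \<kappa> r. D \<inter> a = d a}"
    using ITP unfolding ITP_def ineffable_branch_def by blast
  have branch: "\<exists>a \<alpha> C. is_sup a \<alpha> \<and> C \<in> \<C> \<alpha> \<and> B \<subseteq> a \<and> f ` a \<subseteq> a \<and>
      (\<forall>z\<in>a. z \<in> D \<longleftrightarrow> meets C (fst (q z)) (snd (q z)))"
    if B: "B \<subseteq> Field r" "|B| <o \<kappa>" and f: "f ` Field r \<subseteq> Field r" for B f
  proof -
    obtain x where x: "x \<in> Field r"
      using assms by fastforce
    \<comment> \<open>The point x makes \<open>a\<close> nonempty, and closure under
      \<open>next_elt\<close> deprives it of a maximum, so that \<open>ex_is_sup\<close> applies to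
      any \<open>a\<close> in this club.\<close>
    have "Pk_club \<kappa> r {a \<in> Pk \<kappa> r. insert x B \<subseteq> a \<and> (\<forall>z\<in>a. {f z, next_elt z} \<subseteq> a)}"
    proof (rule Pk_club_closed)
      show "insert x B \<in> Pk \<kappa> r"
        using small_Un[of "{x}" B] small_finite[of "{x}"] x B unfolding Pk_def by simp
    qed (use f next_elt(1) less_Field in auto)
    then obtain a where "a \<in> {a \<in> Pk \<kappa> r. D \<inter> a = d a}
        \<inter> {a \<in> Pk \<kappa> r. insert x B \<subseteq> a \<and> (\<forall>z\<in>a. {f z, next_elt z} \<subseteq> a)}"
      using D unfolding Pk_stationary_def by blast
    then have a: "a \<in> Pk \<kappa> r" "D \<inter> a = d a" "insert x B \<subseteq> a"
      "\<And>z. z \<in> a \<Longrightarrow> f z \<in> a \<and> next_elt z \<in> a"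
      by simp_all
    then have "\<exists>\<alpha>. is_sup a \<alpha>"
      using next_elt(1) unfolding Pk_def by (intro ex_is_sup) blast+
    then obtain \<alpha> where "is_sup a \<alpha>" "K a \<in> \<C> \<alpha>"
      using K_sup by blast
    moreover have "\<forall>z\<in>a. z \<in> D \<longleftrightarrow> meets (K a) (fst (q z)) (snd (q z))"
      using a(2) unfolding d_def by blast
    ultimately show ?thesis
      using a(3,4) by blast
  qed
  show False
  proof (rule no_uniform_answers)
    fix P assume P: "P \<subseteq> Field r \<times> Field r" "|P| <o \<kappa>"
    have "case_prod p ` P \<subseteq> Field r" "|case_prod p ` P| <o \<kappa>" "id ` Field r \<subseteq> Field r"
      using P p(1) by (auto intro: small_image)
    from branch[OF this] obtain a \<alpha> C where "is_sup a \<alpha>" "C \<in> \<C> \<alpha>" "case_prod p ` P \<subseteq> a"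
      and C: "\<forall>z\<in>a. z \<in> D \<longleftrightarrow> meets C (fst (q z)) (snd (q z))"
      by metis
    moreover have "\<forall>(x, y)\<in>P. p x y \<in> D \<longleftrightarrow> meets C x y"
    proof clarify
      fix x y assume "(x, y) \<in> P"
      then have "p x y \<in> a" "x \<in> Field r" "y \<in> Field r"
        using \<open>case_prod p ` P \<subseteq> a\<close> P(1) by auto
      then show "p x y \<in> D \<longleftrightarrow> meets C x y"
        using C p(2) by simp
    qed
    ultimately show "\<exists>\<alpha>\<in>index. \<exists>C\<in>\<C> \<alpha>. \<forall>(x, y)\<in>P. p x y \<in> D \<longleftrightarrow> meets C x y"
      unfolding is_sup_def by blast
  next
    fix x assume x: "x \<in> Field r"
    \<comment> \<open>Closure under \<open>p x\<close> puts the code of (x, y) into \<open>a\<close>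
      for every y in \<open>a\<close>. As C is unbounded in the supremum of \<open>a\<close>, some
      such y lies above a point of C that is at least x.\<close>
    have "{x} \<subseteq> Field r" "|{x}| <o \<kappa>" "p x ` Field r \<subseteq> Field r"
      using x p(1) small_finite[of "{x}"] by auto
    then obtain a \<alpha> C where a: "is_sup a \<alpha>" "{x} \<subseteq> a" "p x ` a \<subseteq> a" and "C \<in> \<C> \<alpha>"
      and C: "\<forall>z\<in>a. z \<in> D \<longleftrightarrow> meets C (fst (q z)) (snd (q z))"
      using branch[of "{x}" "p x"] by metis
    then have "club_in r (underS r \<alpha>) C" "x \<prec> \<alpha>"
      using club_C unfolding is_sup_def unbounded_in_def by blast+
    then obtain \<zeta> where \<zeta>: "\<zeta> \<in> C" "(x, \<zeta>) \<in> r" "\<zeta> \<prec> \<alpha>"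
      unfolding club_in_def unbounded_in_def by blast
    then obtain y where y: "y \<in> a" "\<zeta> \<prec> y"
      using is_sup_less[OF a(1)] by blast
    then have "meets C x y" "p x y \<in> a" "y \<in> Field r"
      using \<zeta> a(3) less_Field unfolding meets_def by blast+
    then show "\<exists>y\<in>Field r. p x y \<in> D"
      using C p(2)[OF x] by auto
  qed
qed

end

theorem theorem4p2:
  fixes \<kappa> :: "'b rel" and \<Lambda> :: "'a rel"
  assumes "Card_order \<kappa>" and "Card_order \<Lambda>" and "\<kappa> \<le>o \<Lambda>"
    and "regularCard \<kappa>" and "natLeq <o \<kappa>"
    and "\<kappa> \<le>o cofinality \<Lambda> (Field \<Lambda>)"
    and "square (cof_less \<kappa> \<Lambda>) \<kappa> \<Lambda>"
  shows "\<not> ITP \<kappa> \<Lambda>"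
proof -
  obtain \<C> where "square_sequence (cof_less \<kappa> \<Lambda>) \<kappa> \<Lambda> \<C>"
    using assms(7) unfolding square_def by blast
  then interpret square_setting \<kappa> \<Lambda> \<C>
    using assms card_order_on_well_order_on by unfold_locales blast+
  \<comment> \<open>A finite \<lambda> would be small, hence strictly bounded by one of its own
    elements.\<close>
  have "infinite (Field \<Lambda>)"
  proof
    assume "finite (Field \<Lambda>)"
    then obtain \<beta> where "\<beta> \<in> Field \<Lambda>" "Field \<Lambda> \<subseteq> underS \<Lambda> \<beta>"
      using bounded[OF order_refl small_finite] by blast
    then show False
      using irrefl by blast
  qed
  then show ?thesis
    by (rule not_ITP)
qed

end
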